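(* Let $Q_1,\dots,Q_r\in\mathbb{R}^{m\times m}$ be symmetric matrices, let $q_i(z)=z^\top Q_i z$, let $C=\sum_{i=1}^r\|Q_i\|_F^2$ and $B=C+1$, and define the homogeneous quartic $p(z)=B\,(\|z\|^2)^2-\sum_{i=1}^r q_i(z)^2$. Then $\max_{\|z\|=1}p(z)=B$ if and only if there exists $z\in S^{m-1}$ with $q_i(z)=0$ for all $i=1,\dots,r$.
   Context: $\|\cdot\|$ is the Euclidean norm, $S^{m-1}=\{z\in\mathbb{R}^m:\|z\|=1\}$, and $\|Q\|_F=\sqrt{\sum_{i,j}Q_{ij}^2}$ is the Frobenius norm. *)

theory Defs
  imports "HOL-Analysis.Analysis"
begin

definition frobenius_norm :: "real^'n^'m \<Rightarrow> real" where
  "frobenius_norm A = sqrt (\<Sum>i\<in>UNIV. \<Sum>j\<in>UNIV. (A $ i $ j)\<^sup>2)"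

definition quad_form :: "real^'m^'m \<Rightarrow> real^'m \<Rightarrow> real" where
  "quad_form A z = z \<bullet> (A *v z)"

definition const_C :: "nat \<Rightarrow> (nat \<Rightarrow> real^'m^'m) \<Rightarrow> real" where
  "const_C r Q = (\<Sum>i=1..r. (frobenius_norm (Q i))\<^sup>2)"

definition const_B :: "nat \<Rightarrow> (nat \<Rightarrow> real^'m^'m) \<Rightarrow> real" where
  "const_B r Q = const_C r Q + 1"

definition quartic :: "nat \<Rightarrow> (nat \<Rightarrow> real^'m^'m) \<Rightarrow> real^'m \<Rightarrow> real" where
  "quartic r Q z = const_B r Q * ((norm z)\<^sup>2)\<^sup>2 - (\<Sum>i=1..r. (quad_form (Q i) z)\<^sup>2)"

text \<open>The attained maximum of \<open>f\<close> on \<open>S\<close>, i.e. the greatest element of the image. It is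
  meaningful only when such an element exists, for instance for continuous \<open>f\<close> and compact
  nonempty \<open>S\<close>; \<^const>\<open>Max\<close> is not usable because it is restricted to finite sets.\<close>

definition max_on :: "'a set \<Rightarrow> ('a \<Rightarrow> real) \<Rightarrow> real" where
  "max_on S f = (GREATEST v. v \<in> f ` S)"

end

theory Submission
  imports Defs
begin

lemma max_on_eqI:
  assumes "z \<in> S" "\<And>w. w \<in> S \<Longrightarrow> f w \<le> f z"
  shows "max_on S f = f z"
  unfolding max_on_def using assms by (intro Greatest_equality) auto

lemma max_on_eq_upper_bound_iff:
  fixes S :: "'a::topological_space set" and f :: "'a \<Rightarrow> real"
  assumes "compact S" "S \<noteq> {}" "continuous_on S f"
    and upper_bound: "\<And>z. z \<in> S \<Longrightarrow> f z \<le> b"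
  shows "max_on S f = b \<longleftrightarrow> (\<exists>z\<in>S. f z = b)"
proof
  assume "max_on S f = b"
  moreover obtain z where "z \<in> S" "\<And>w. w \<in> S \<Longrightarrow> f w \<le> f z"
    using continuous_attains_sup[OF assms(1-3)] by blast
  moreover from this have "max_on S f = f z"
    by (rule max_on_eqI)
  ultimately show "\<exists>z\<in>S. f z = b"
    by auto
next
  assume "\<exists>z\<in>S. f z = b"
  then show "max_on S f = b"
    using upper_bound max_on_eqI by metis
qed

lemma continuous_on_quad_form [continuous_intros]:
  assumes "continuous_on S f"
  shows "continuous_on S (\<lambda>x. quad_form A (f x))"
  unfolding quad_form_def
  by (intro continuous_on_inner assms
      continuous_on_compose2[OF matrix_vector_mult_linear_continuous_on assms subset_UNIV])

lemma continuous_on_quartic: "continuous_on S (quartic r Q)"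
  unfolding quartic_def by (intro continuous_intros)

lemma quartic_le_const_B: "quartic r Q z \<le> const_B r Q * ((norm z)\<^sup>2)\<^sup>2"
  by (simp add: quartic_def sum_nonneg)

lemma quartic_eq_const_B_iff:
  "quartic r Q z = const_B r Q * ((norm z)\<^sup>2)\<^sup>2 \<longleftrightarrow> (\<forall>i\<in>{1..r}. quad_form (Q i) z = 0)"
proof -
  have "quartic r Q z = const_B r Q * ((norm z)\<^sup>2)\<^sup>2
      \<longleftrightarrow> (\<Sum>i=1..r. (quad_form (Q i) z)\<^sup>2) = 0"
    by (simp add: quartic_def)
  also have "\<dots> \<longleftrightarrow> (\<forall>i\<in>{1..r}. quad_form (Q i) z = 0)"
    by (simp add: sum_nonneg_eq_0_iff)
  finally show ?thesis .
qed

theorem mainTheorem6: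
  fixes Q :: "nat \<Rightarrow> real^'m^'m" and r :: nat
  assumes "\<And>i. i \<in> {1..r} \<Longrightarrow> transpose (Q i) = Q i"
  shows "max_on (sphere 0 1) (quartic r Q) = const_B r Q \<longleftrightarrow>
    (\<exists>z\<in>sphere (0 :: real^'m) 1. \<forall>i\<in>{1..r}. quad_form (Q i) z = 0)"
proof -
  have upper_bound: "quartic r Q z \<le> const_B r Q" if "z \<in> sphere 0 1" for z
    using quartic_le_const_B[of r Q z] that by simp
  have attained_iff: "quartic r Q z = const_B r Q \<longleftrightarrow> (\<forall>i\<in>{1..r}. quad_form (Q i) z = 0)"
    if "z \<in> sphere 0 1" for z
    using quartic_eq_const_B_iff[of r Q z] that by simp
  have "max_on (sphere 0 1) (quartic r Q) = const_B r Q
      \<longleftrightarrow> (\<exists>z\<in>sphere 0 1. quartic r Q z = const_B r Q)"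
    using upper_bound
    by (intro max_on_eq_upper_bound_iff compact_sphere continuous_on_quartic) auto
  also have "\<dots> \<longleftrightarrow> (\<exists>z\<in>sphere 0 1. \<forall>i\<in>{1..r}. quad_form (Q i) z = 0)"
    using attained_iff by (rule bex_cong[OF refl])
  finally show ?thesis .
qed

end
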